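(* Let $f=h+\overline{g}\in\mathcal{S}_H^0$ be such that $g'(z)=zh'(z)$. Then $f$ is fully starlike in $\mathbb{D}$ if and only if $$h(z)*A(z)-\overline{z}\left(\overline{h(z)}*\overline{B(z)}\right)\neq 0\quad\text{for all } |\zeta|=1,\ 0<|z|<1,$$ where $$A(z)=\frac{2z+(\zeta-1)z^2}{(1-z)^2}\quad\text{and}\quad B(z)=\frac{2z^2+z(\overline{\zeta}-1)+(1-z)^2(\overline{\zeta}-1)\log(1-z)}{z(1-z)^2}.$$
   Context: $\mathbb{D}=\{z\in\mathbb{C}:|z|<1\}$. $\mathcal{H}$ is the class of complex-valued harmonic functions $f=h+\overline{g}$ in $\mathbb{D}$ with $h(z)=z+\sum_{n=2}^\infty a_nz^n$ and $g(z)=\sum_{n=1}^\infty b_nz^n$ analytic in $\mathbb{D}$. $\mathcal{S}_H$ is the class of $f\in\mathcal{H}$ that are univalent and sense-preserving (i.e. $|h'|^2-|g'|^2>0$) in $\mathbb{D}$, and $\mathcal{S}_H^0=\{f\in\mathcal{S}_H: b_1=g'(0)=0\}$. The symbol $*$ denotes the Hadamard product (convolution): $\left(\sum \alpha_nz^n\right)*\left(\sum\beta_nz^n\right)=\sum\alpha_n\beta_nz^n$, and $\overline{h}*\overline{B}=\overline{h*B}$. The functions $A,B$ depend on the parameter $\zeta$; $\log$ is the principal branch, and $B$ is analytic in $\mathbb{D}$ (removable singularity at $0$). A function $f=h+\overline g\in\mathcal{S}_H^0$ is fully starlike in $\mathbb{D}$ if $$\mathrm{Re}\left(\frac{zh'(z)-\overline{zg'(z)}}{h(z)+\overline{g(z)}}\right)>0\quad\text{for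 all } z\in\mathbb{D}\setminus\{0\},$$ i.e. $\frac{\partial}{\partial\theta}\arg f(re^{i\theta})>0$ for all $0<r<1$ and all $\theta$ (so that each disk $|z|<r$, $0<r<1$, is mapped onto a domain starlike with respect to the origin). *)

theory Defs
  imports "HOL-Complex_Analysis.Complex_Analysis"
begin

abbreviation unit_disc :: "complex set" where
  "unit_disc \<equiv> ball 0 1"

text \<open>
  The functions \<open>h\<close> and \<open>g\<close> are uniquely determined by \<open>f\<close> on the disc, because of the
  normalisation \<open>h 0 = g 0 = 0\<close>. Harmonicity of \<open>f\<close> is implied by the decomposition.
  Values outside the disc are irrelevant.
\<close>
definition class_H :: "(complex \<Rightarrow> complex) \<Rightarrow> (complex \<Rightarrow> complex) \<Rightarrow> (complex \<Rightarrow> complex) \<Rightarrow> bool" where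
  "class_H f h g \<longleftrightarrow>
     h holomorphic_on unit_disc \<and> h 0 = 0 \<and> deriv h 0 = 1 \<and>
     g holomorphic_on unit_disc \<and> g 0 = 0 \<and>
     (\<forall>z\<in>unit_disc. f z = h z + cnj (g z))"

definition sense_preserving :: "(complex \<Rightarrow> complex) \<Rightarrow> (complex \<Rightarrow> complex) \<Rightarrow> bool" where
  "sense_preserving h g \<longleftrightarrow>
     (\<forall>z\<in>unit_disc. (cmod (deriv h z))\<^sup>2 - (cmod (deriv g z))\<^sup>2 > 0)"

definition class_SH :: "(complex \<Rightarrow> complex) \<Rightarrow> (complex \<Rightarrow> complex) \<Rightarrow> (complex \<Rightarrow> complex) \<Rightarrow> bool" where
  "class_SH f h g \<longleftrightarrow> class_H f h g \<and> inj_on f unit_disc \<and> sense_preserving h g"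

definition class_SH0 :: "(complex \<Rightarrow> complex) \<Rightarrow> (complex \<Rightarrow> complex) \<Rightarrow> (complex \<Rightarrow> complex) \<Rightarrow> bool" where
  "class_SH0 f h g \<longleftrightarrow> class_SH f h g \<and> deriv g 0 = 0"

text \<open>
  Meant for \<open>f = h + cnj g\<close> in \<^const>\<open>class_SH0\<close>. There the denominator has no zero in the
  punctured disc, by injectivity.
\<close>
definition fully_starlike :: "(complex \<Rightarrow> complex) \<Rightarrow> (complex \<Rightarrow> complex) \<Rightarrow> bool" where
  "fully_starlike h g \<longleftrightarrow>
     (\<forall>z\<in>unit_disc - {0}.
        Re ((z * deriv h z - cnj (z * deriv g z)) / (h z + cnj (g z))) > 0)"

text \<open>Meant for functions that are holomorphic in the unit disc.\<close>
definition hadamard :: "(complex \<Rightarrow> complex) \<Rightarrow> (complex \<Rightarrow> complex) \<Rightarrow> complex \<Rightarrow> complex"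
    (infixl \<open>\<star>\<close> 70) where
  "(F \<star> G) z = (\<Sum>n. fps_nth (fps_expansion F 0) n * fps_nth (fps_expansion G 0) n * z ^ n)"

definition A_fun :: "complex \<Rightarrow> complex \<Rightarrow> complex" where
  "A_fun \<zeta> z = (2 * z + (\<zeta> - 1) * z\<^sup>2) / (1 - z)\<^sup>2"

text \<open>The value at \<open>0\<close> is the one that removes the singularity, see \<open>B_fun_holomorphic\<close>.\<close>
definition B_fun :: "complex \<Rightarrow> complex \<Rightarrow> complex" where
  "B_fun \<zeta> z =
     (if z = 0 then 0
      else (2 * z\<^sup>2 + z * (cnj \<zeta> - 1) + (1 - z)\<^sup>2 * (cnj \<zeta> - 1) * Ln (1 - z))
             / (z * (1 - z)\<^sup>2))"

lemma B_fun_holomorphic: "B_fun \<zeta> holomorphic_on unit_disc"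
proof (rule pole_theorem_0)
  let ?N = "\<lambda>z. (2 * z\<^sup>2 + z * (cnj \<zeta> - 1)) / (1 - z)\<^sup>2 + (cnj \<zeta> - 1) * Ln (1 - z)"
  have nz: "1 - z \<notin> \<real>\<^sub>\<le>\<^sub>0" "1 - z \<noteq> 0" if "z \<in> unit_disc" for z :: complex
    using that complex_Re_le_cmod[of z] by (auto simp: complex_nonpos_Reals_iff)
  show "?N holomorphic_on unit_disc"
    using nz by (auto intro!: holomorphic_intros)
  show "?N z = (z - 0) * B_fun \<zeta> z" if "z \<in> unit_disc - {0}" for z
    using that nz(2)[of z] by (simp add: B_fun_def field_simps)
  have "(?N has_field_derivative 0) (at 0)"
    by (auto intro!: derivative_eq_intros)
  then show "B_fun \<zeta> 0 = deriv ?N 0"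
    by (simp add: B_fun_def DERIV_imp_deriv)
qed (auto simp: interior_open)

end

theory Submission
  imports Defs
begin

text \<open>
  Put \<open>P z = z h'(z) - cnj (z g'(z))\<close> and \<open>Q = h + cnj g\<close>, so that full starlikeness says
  \<open>Re (P/Q) > 0\<close>. Since \<open>g' = z h'\<close> determines the coefficients of \<open>g\<close> from those of \<open>h\<close>, the
  convolution expression equals \<open>(\<zeta> + 1) P - (\<zeta> - 1) Q\<close>. Its vanishing for some unimodular
  \<open>\<zeta>\<close> means that \<open>P/Q\<close> is purely imaginary: \<open>\<zeta> = -1\<close> is excluded because \<open>Q\<close> has no zero in the
  punctured disc, by injectivity, and \<open>(\<zeta> - 1)/(\<zeta> + 1)\<close> runs through the imaginary axis for the
  other \<open>\<zeta>\<close>. Finally \<open>P/Q\<close> is continuous on the connected punctured disc and tends to \<open>1\<close> at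
  \<open>0\<close>, so if its real part never vanishes, it is positive.
\<close>

section \<open>Power series on the unit disc and the multiplier \<open>n\<close> of
  \<open>z * deriv F z\<close>\<close>

lemma fps_nth_fps_expansion_eqI:
  fixes F :: "complex \<Rightarrow> complex"
  assumes "\<And>z. z \<in> unit_disc \<Longrightarrow> (\<lambda>n. c n * z ^ n) sums F z"
  shows "fps_nth (fps_expansion F 0) n = c n"
proof -
  have "\<forall>\<^sub>F z in nhds 0. (\<lambda>n. fps_nth (Abs_fps c) n * z ^ n) sums F z"
    using eventually_nhds_in_open[of unit_disc 0] assms by (auto elim: eventually_mono)
  then have "F has_fps_expansion Abs_fps c"
    by (rule has_fps_expansionI)
  then show ?thesis
    using fps_expansion_eqI by fastforce
qed

lemma fps_expansion_sums:
  assumes "F holomorphic_on unit_disc" "z \<in> unit_disc"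
  shows "(\<lambda>n. fps_nth (fps_expansion F 0) n * z ^ n) sums F z"
  using holomorphic_power_series[OF assms] by (simp add: fps_expansion_def)

lemma fps_nth_fps_expansion_deriv:
  "fps_nth (fps_expansion (deriv F) z) n = of_nat (Suc n) * fps_nth (fps_expansion F z) (Suc n)"
proof -
  have "(deriv ^^ n) (deriv F) z = (deriv ^^ Suc n) F z"
    by (simp add: funpow_Suc_right del: funpow.simps)
  then show ?thesis
    by (simp add: fps_expansion_def divide_simps del: funpow.simps of_nat_Suc)
qed

lemma id_times_deriv_sums:
  assumes "F holomorphic_on unit_disc" "z \<in> unit_disc"
  shows "(\<lambda>n. of_nat n * fps_nth (fps_expansion F 0) n * z ^ n) sums (z * deriv F z)"
proof -
  have "(\<lambda>n. fps_nth (fps_expansion (deriv F) 0) n * z ^ n) sums deriv F z"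
    using assms by (intro fps_expansion_sums holomorphic_deriv) auto
  then have "(\<lambda>n. z * (fps_nth (fps_expansion (deriv F) 0) n * z ^ n)) sums (z * deriv F z)"
    by (rule sums_mult)
  then have "(\<lambda>n. of_nat (Suc n) * fps_nth (fps_expansion F 0) (Suc n) * z ^ Suc n)
      sums (z * deriv F z)"
    by (simp add: fps_nth_fps_expansion_deriv mult_ac)
  \<comment> \<open>The term of index 0 is 0, so shifting the index keeps the sum.\<close>
  then show ?thesis
    using sums_Suc_iff[of "\<lambda>n. of_nat n * fps_nth (fps_expansion F 0) n * z ^ n"] by simp
qed

section \<open>Taylor coefficients of \<open>A_fun\<close> and \<open>B_fun\<close>\<close>

lemma of_nat_times_power_sums:
  fixes z :: complex
  assumes "cmod z < 1"
  shows "(\<lambda>n. of_nat n * z ^ n) sums (z / (1 - z)\<^sup>2)"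
proof -
  have "(\<lambda>n. z * (of_nat (Suc n) * z ^ n)) sums (z * (1 / (1 - z)\<^sup>2))"
    by (intro sums_mult geometric_deriv_sums assms)
  then show ?thesis
    using sums_Suc_iff[of "\<lambda>n. of_nat n * z ^ n"] by (simp add: mult_ac)
qed

text \<open>Partial fractions: \<open>A_fun\<close> is \<open>\<zeta> + 1\<close> times the Koebe
  function \<open>z / (1 - z)\<^sup>2\<close> minus \<open>\<zeta> - 1\<close> times
  \<open>z / (1 - z)\<close>. Under convolution the former acts as \<open>z * deriv h z\<close>, the
  latter as the identity on series without constant term.\<close>

lemma fps_nth_A_fun:
  "fps_nth (fps_expansion (A_fun \<zeta>) 0) n
    = (if n = 0 then 0 else (\<zeta> + 1) * of_nat n - (\<zeta> - 1))"
proof (rule fps_nth_fps_expansion_eqI)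
  fix z :: complex assume "z \<in> unit_disc"
  then have z: "cmod z < 1" "z \<noteq> 1" by auto
  have "(\<lambda>n. (\<zeta> + 1) * (of_nat n * z ^ n) - (\<zeta> - 1) * (z ^ n - (if n = 0 then 1 else 0) * z ^ n))
     sums ((\<zeta> + 1) * (z / (1 - z)\<^sup>2) - (\<zeta> - 1) * (1 / (1 - z) - 1))"
    using powser_sums_if[of 0 z]
    by (intro sums_diff sums_mult of_nat_times_power_sums geometric_sums z) simp
  moreover have "(\<zeta> + 1) * (z / (1 - z)\<^sup>2) - (\<zeta> - 1) * (1 / (1 - z) - 1) = A_fun \<zeta> z"
  proof -
    have "1 - z \<noteq> 0" using z by simp
    then show ?thesis
      unfolding A_fun_def by (simp add: divide_simps) (simp add: algebra_simps power2_eq_square)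
  qed
  moreover have "(\<lambda>n. (\<zeta> + 1) * (of_nat n * z ^ n)
        - (\<zeta> - 1) * (z ^ n - (if n = 0 then 1 else 0) * z ^ n))
      = (\<lambda>n. (if n = 0 then 0 else (\<zeta> + 1) * of_nat n - (\<zeta> - 1)) * z ^ n)"
    by (auto simp: fun_eq_iff algebra_simps)
  ultimately show "(\<lambda>n. (if n = 0 then 0 else (\<zeta> + 1) * of_nat n - (\<zeta> - 1)) * z ^ n)
      sums A_fun \<zeta> z"
    by simp
qed

text \<open>Here the Koebe function is combined with \<open>1 / (1 - z) + Ln (1 - z) / z\<close>,
  whose coefficients are \<open>1 - 1 / (n + 1) = n / (n + 1)\<close>. This is the factor that the
  equation \<open>g' = z h'\<close> puts between the coefficients of \<open>h\<close> and those of
  \<open>g z / z\<close>.\<close>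

lemma fps_nth_B_fun:
  "fps_nth (fps_expansion (B_fun \<zeta>) 0) n
    = (cnj \<zeta> + 1) * of_nat n + (cnj \<zeta> - 1) * (of_nat n / of_nat (Suc n))"
proof (rule fps_nth_fps_expansion_eqI)
  fix z :: complex assume "z \<in> unit_disc"
  then have z: "cmod z < 1" "z \<noteq> 1" by auto
  let ?b = "\<lambda>n. (cnj \<zeta> + 1) * of_nat n + (cnj \<zeta> - 1) * (of_nat n / of_nat (Suc n)) :: complex"
  show "(\<lambda>n. ?b n * z ^ n) sums B_fun \<zeta> z"
  \<comment> \<open>At 0 the value 0 set in \<open>B_fun\<close> agrees with the coefficient of
    index 0.\<close>
  proof (cases "z = 0")
    case True
    then show ?thesis
      using powser_sums_zero[of ?b] by (simp add: B_fun_def)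
  next
    case False
    have "(\<lambda>n. - (z ^ n) / of_nat n) sums Ln (1 - z)"
      using Ln_series'[of "- z"] z by simp
    then have "(\<lambda>n. - (z ^ Suc n) / of_nat (Suc n)) sums Ln (1 - z)"
      using sums_Suc_iff[of "\<lambda>n. - (z ^ n) / of_nat n" "Ln (1 - z)"] by simp
    then have "(\<lambda>n. - (z ^ Suc n) / of_nat (Suc n) / z) sums (Ln (1 - z) / z)"
      by (rule sums_divide)
    then have log: "(\<lambda>n. - (z ^ n / of_nat (Suc n))) sums (Ln (1 - z) / z)"
      using False by (simp add: divide_simps del: of_nat_Suc)
    have "(\<lambda>n. (cnj \<zeta> + 1) * (of_nat n * z ^ n)
          + (cnj \<zeta> - 1) * (z ^ n + - (z ^ n / of_nat (Suc n))))
        sums ((cnj \<zeta> + 1) * (z / (1 - z)\<^sup>2) + (cnj \<zeta> - 1) * (1 / (1 - z) + Ln (1 - z) / z))"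
      by (intro sums_add sums_mult of_nat_times_power_sums geometric_sums log z)
    moreover have "(cnj \<zeta> + 1) * (z / (1 - z)\<^sup>2)
        + (cnj \<zeta> - 1) * (1 / (1 - z) + Ln (1 - z) / z) = B_fun \<zeta> z"
    proof -
      have "1 - z \<noteq> 0" using z by simp
      then show ?thesis
        unfolding B_fun_def using False
        by (simp add: divide_simps) (simp add: algebra_simps power2_eq_square)
    qed
    moreover have "(cnj \<zeta> + 1) * (of_nat n * z ^ n)
        + (cnj \<zeta> - 1) * (z ^ n + - (z ^ n / of_nat (Suc n))) = ?b n * z ^ n" for n
    proof -
      have "z ^ n + - (z ^ n / of_nat (Suc n)) = of_nat n / of_nat (Suc n) * z ^ n"
        using of_nat_neq_0[of n, where 'a = complex]
        by (simp add: divide_simps del: of_nat_Suc) (simp add: algebra_simps)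
      then show ?thesis
        by (simp only: distrib_right mult.assoc)
    qed
    ultimately show ?thesis
      by simp
  qed
qed

section \<open>Convolutions of \<open>h\<close> with \<open>A_fun\<close> and \<open>B_fun\<close>
  in closed form\<close>

lemma hadamard_A_fun:
  assumes "h holomorphic_on unit_disc" "h 0 = 0" "z \<in> unit_disc"
  shows "(h \<star> A_fun \<zeta>) z = (\<zeta> + 1) * (z * deriv h z) - (\<zeta> - 1) * h z"
proof -
  let ?a = "\<lambda>n. fps_nth (fps_expansion h 0) n"
  \<comment> \<open>This covers index 0, where \<open>A_fun\<close> has coefficient 0 but the
    general formula would give \<open>- (\<zeta> - 1)\<close>.\<close>
  have "?a 0 = 0"
    using assms(2) by (simp add: fps_expansion_def)
  then have "?a n * fps_nth (fps_expansion (A_fun \<zeta>) 0) n * z ^ n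
      = (\<zeta> + 1) * (of_nat n * ?a n * z ^ n) - (\<zeta> - 1) * (?a n * z ^ n)" for n
    by (simp add: fps_nth_A_fun algebra_simps)
  moreover have "(\<lambda>n. (\<zeta> + 1) * (of_nat n * ?a n * z ^ n) - (\<zeta> - 1) * (?a n * z ^ n))
      sums ((\<zeta> + 1) * (z * deriv h z) - (\<zeta> - 1) * h z)"
    by (intro sums_diff sums_mult id_times_deriv_sums fps_expansion_sums assms)
  ultimately show ?thesis
    unfolding hadamard_def by (simp add: sums_iff)
qed

lemma hadamard_B_fun:
  assumes h: "h holomorphic_on unit_disc"
    and g: "g holomorphic_on unit_disc" "g 0 = 0"
    and dg: "\<And>z. z \<in> unit_disc \<Longrightarrow> deriv g z = z * deriv h z"
    and z: "z \<in> unit_disc"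
  shows "z * (h \<star> B_fun \<zeta>) z = (cnj \<zeta> + 1) * (z * deriv g z) + (cnj \<zeta> - 1) * g z"
proof (cases "z = 0")
  case False
  let ?a = "\<lambda>n. fps_nth (fps_expansion h 0) n"
  let ?b = "\<lambda>n. fps_nth (fps_expansion g 0) n"
  \<comment> \<open>Both sides are the coefficient of index \<open>n\<close> of
    \<open>deriv g\<close>, the right one through \<open>z * deriv h z\<close>.\<close>
  have "of_nat (Suc n) * ?b (Suc n) = of_nat n * ?a n" for n
    unfolding fps_nth_fps_expansion_deriv [symmetric]
    by (rule fps_nth_fps_expansion_eqI) (simp add: dg id_times_deriv_sums [OF h])
  then have b_Suc: "?b (Suc n) = of_nat n / of_nat (Suc n) * ?a n" for n
    by (simp add: field_simps del: of_nat_Suc)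
  have "?b 0 = 0"
    using g(2) by (simp add: fps_expansion_def)
  then have "(\<lambda>n. ?b (Suc n) * z ^ Suc n) sums g z"
    using fps_expansion_sums[OF g(1) z] sums_Suc_iff[of "\<lambda>n. ?b n * z ^ n" "g z"] by simp
  then have "(\<lambda>n. ?b (Suc n) * z ^ Suc n / z) sums (g z / z)"
    by (rule sums_divide)
  then have g_sums: "(\<lambda>n. of_nat n / of_nat (Suc n) * ?a n * z ^ n) sums (g z / z)"
    using False by (simp add: b_Suc mult.assoc del: of_nat_Suc)
  have "?a n * fps_nth (fps_expansion (B_fun \<zeta>) 0) n * z ^ n
      = (cnj \<zeta> + 1) * (of_nat n * ?a n * z ^ n)
        + (cnj \<zeta> - 1) * (of_nat n / of_nat (Suc n) * ?a n * z ^ n)" for n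
    by (simp add: fps_nth_B_fun algebra_simps del: of_nat_Suc)
  moreover have "(\<lambda>n. (cnj \<zeta> + 1) * (of_nat n * ?a n * z ^ n)
        + (cnj \<zeta> - 1) * (of_nat n / of_nat (Suc n) * ?a n * z ^ n))
      sums ((cnj \<zeta> + 1) * (z * deriv h z) + (cnj \<zeta> - 1) * (g z / z))"
    by (intro sums_add sums_mult id_times_deriv_sums g_sums h z)
  ultimately have "(h \<star> B_fun \<zeta>) z
      = (cnj \<zeta> + 1) * (z * deriv h z) + (cnj \<zeta> - 1) * (g z / z)"
    unfolding hadamard_def by (simp add: sums_iff)
  then show ?thesis
    using False by (simp add: dg[OF z] field_simps)
qed (simp add: g)

section \<open>Unimodular parameters and purely imaginary quotients\<close>

lemma ex_unimodular_iff_Re_eq_0: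
  fixes P Q :: complex
  assumes "Q \<noteq> 0"
  shows "(\<exists>\<zeta>. cmod \<zeta> = 1 \<and> (\<zeta> + 1) * P - (\<zeta> - 1) * Q = 0) \<longleftrightarrow> Re (P / Q) = 0"
proof
  assume "\<exists>\<zeta>. cmod \<zeta> = 1 \<and> (\<zeta> + 1) * P - (\<zeta> - 1) * Q = 0"
  then obtain \<zeta> where \<zeta>: "cmod \<zeta> = 1" "(\<zeta> + 1) * P - (\<zeta> - 1) * Q = 0" by blast
  define w where "w = P / Q"
  have "P = w * Q"
    using assms by (simp add: w_def)
  then have "((\<zeta> + 1) * w - (\<zeta> - 1)) * Q = 0"
    using \<zeta>(2) by (simp add: algebra_simps)
  then have "(\<zeta> + 1) * w - (\<zeta> - 1) = 0"
    using assms by simp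
  \<comment> \<open>Without dividing by \<open>\<zeta> + 1\<close>, moduli show that
    \<open>w\<close> is equidistant from 1 and -1. The squared distances differ by
    \<open>4 * Re w\<close>.\<close>
  then have "\<zeta> * (1 - w) = 1 + w"
    by (simp add: algebra_simps)
  then have "cmod (1 - w) = cmod (1 + w)"
    using \<zeta>(1) by (metis mult_1 norm_mult)
  then have "(cmod (1 - w))\<^sup>2 = (cmod (1 + w))\<^sup>2"
    by simp
  then show "Re (P / Q) = 0"
    unfolding cmod_power2 w_def[symmetric] by (simp add: power2_eq_square algebra_simps)
next
  assume "Re (P / Q) = 0"
  define w where "w = P / Q"
  have Re: "Re w = 0" and P: "P = w * Q"
    using assms \<open>Re (P / Q) = 0\<close> by (simp_all add: w_def)
  \<comment> \<open>The Cayley transform, which solves the equation for \<open>\<zeta>\<close> and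
    sends the imaginary axis into the unit circle.\<close>
  define \<zeta> where "\<zeta> = (1 + w) / (1 - w)"
  have "1 - w \<noteq> 0"
    using Re by (metis eq_iff_diff_eq_0 one_complex.sel(1) zero_neq_one)
  moreover have "cmod (1 + w) = cmod (1 - w)"
    using Re by (simp add: cmod_def)
  ultimately have "cmod \<zeta> = 1" "\<zeta> * (1 - w) = 1 + w"
    by (auto simp: \<zeta>_def norm_divide)
  moreover have "(\<zeta> + 1) * P - (\<zeta> - 1) * Q = (1 + w - \<zeta> * (1 - w)) * Q"
    by (simp add: P algebra_simps)
  ultimately show "\<exists>\<zeta>. cmod \<zeta> = 1 \<and> (\<zeta> + 1) * P - (\<zeta> - 1) * Q = 0"
    by (intro exI[of _ \<zeta>]) simp
qed

section \<open>From nonvanishing to positive real part on the punctured disc\<close>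

lemma connected_nonzero_pos:
  fixes u :: "'a :: topological_space \<Rightarrow> real"
  assumes "connected S" "continuous_on S u" "\<And>x. x \<in> S \<Longrightarrow> u x \<noteq> 0"
    and "a \<in> S" "u a > 0" "x \<in> S"
  shows "u x > 0"
proof (rule ccontr)
  assume "\<not> u x > 0"
  moreover have "connected (u ` S)"
    using assms by (intro connected_continuous_image)
  ultimately have "0 \<in> u ` S"
    using connectedD_interval[of "u ` S" "u x" "u a" 0] assms by auto
  then show False
    using assms(3) by auto
qed

text \<open>The quotient has the same modulus as \<open>F z / z\<close>, which tends to the
  derivative 0. A nonzero derivative would leave a limit depending on the direction of
  approach.\<close>

lemma tendsto_cnj_div_id:
  fixes F :: "complex \<Rightarrow> complex"
  assumes "(F has_field_derivative 0) (at 0)" "F 0 = 0"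
  shows "((\<lambda>z. cnj (F z) / z) \<longlongrightarrow> 0) (at 0)"
proof (rule tendsto_norm_zero_cancel)
  have "((\<lambda>z. F z / z) \<longlongrightarrow> 0) (at 0)"
    using assms by (simp add: has_field_derivative_iff)
  then have "((\<lambda>z. cmod (F z / z)) \<longlongrightarrow> 0) (at 0)"
    by (rule tendsto_norm_zero)
  then show "((\<lambda>z. cmod (cnj (F z) / z)) \<longlongrightarrow> 0) (at 0)"
    by (simp add: norm_divide)
qed

text \<open>After dividing numerator and denominator by \<open>z\<close>, the holomorphic parts tend
  to \<open>deriv h 0 = 1\<close>. The conjugated parts vanish in the limit because
  \<open>deriv g 0 = 0\<close>.\<close>

lemma starlike_quotient_tendsto_1:
  fixes h g :: "complex \<Rightarrow> complex"
  assumes h: "h holomorphic_on unit_disc" "h 0 = 0" "deriv h 0 = 1"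
    and g: "g holomorphic_on unit_disc" "g 0 = 0" "deriv g 0 = 0"
  shows "((\<lambda>z. (z * deriv h z - cnj (z * deriv g z)) / (h z + cnj (g z))) \<longlongrightarrow> 1) (at 0)"
proof -
  have [tendsto_intros]: "deriv h \<midarrow>0\<rightarrow> 1"
    using holomorphic_on_imp_continuous_on[OF holomorphic_deriv[OF h(1)]] h(3)
    by (auto simp: continuous_on_eq_continuous_at continuous_at dest!: bspec[of _ _ 0])
  have dh: "(h has_field_derivative 1) (at 0)" and dg: "(g has_field_derivative 0) (at 0)"
    using holomorphic_derivI[OF h(1), of 0] holomorphic_derivI[OF g(1), of 0] h(3) g(3) by auto
  \<comment> \<open>By the product rule the derivative at 0 is \<open>deriv g 0\<close>.\<close>
  have "((\<lambda>z. z * deriv g z) has_field_derivative 0) (at 0)"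
    using DERIV_mult[OF DERIV_ident holomorphic_derivI[OF holomorphic_deriv[OF g(1)], of 0]] g(3)
    by simp
  then have zdg: "((\<lambda>z. cnj (z * deriv g z) / z) \<longlongrightarrow> 0) (at 0)"
    by (intro tendsto_cnj_div_id) simp_all
  have "((\<lambda>z. h z / z) \<longlongrightarrow> 1) (at 0)"
    using dh h(2) by (simp add: has_field_derivative_iff)
  then have "((\<lambda>z. (deriv h z - cnj (z * deriv g z) / z) / (h z / z + cnj (g z) / z))
      \<longlongrightarrow> (1 - 0) / (1 + 0)) (at 0)"
    by (intro tendsto_intros zdg tendsto_cnj_div_id dg g) simp_all
  then have "((\<lambda>z. (deriv h z - cnj (z * deriv g z) / z) / (h z / z + cnj (g z) / z))
      \<longlongrightarrow> 1) (at 0)"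
    by simp
  then show ?thesis
    by (rule Lim_transform_eventually)
      (auto intro!: eventually_mono[OF eventually_neq_at_within[of 0]]
        simp: diff_divide_eq_iff add_divide_distrib[symmetric] mult.commute)
qed

lemma class_SH0_nonzero:
  assumes "class_SH0 f h g" "z \<in> unit_disc - {0}"
  shows "h z + cnj (g z) \<noteq> 0"
proof -
  have "inj_on f unit_disc" "f z = h z + cnj (g z)" "f 0 = 0"
    using assms by (auto simp: class_SH0_def class_SH_def class_H_def)
  then show ?thesis
    using assms(2) inj_onD[of f unit_disc z 0] by auto
qed

lemma fully_starlike_iff_Re_neq_0:
  assumes "class_SH0 f h g"
  shows "fully_starlike h g \<longleftrightarrow>
    (\<forall>z\<in>unit_disc - {0}. Re ((z * deriv h z - cnj (z * deriv g z)) / (h z + cnj (g z))) \<noteq> 0)"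
proof -
  define w where "w = (\<lambda>z. (z * deriv h z - cnj (z * deriv g z)) / (h z + cnj (g z)))"
  have hol: "h holomorphic_on unit_disc" "h 0 = 0" "deriv h 0 = 1"
      "g holomorphic_on unit_disc" "g 0 = 0" "deriv g 0 = 0"
    using assms by (auto simp: class_SH0_def class_SH_def class_H_def)
  note nz = class_SH0_nonzero[OF assms]
  have pos: "Re (w z) > 0"
    if neq: "\<And>z. z \<in> unit_disc - {0} \<Longrightarrow> Re (w z) \<noteq> 0" and z: "z \<in> unit_disc - {0}" for z
  proof -
    have cont: "continuous_on (unit_disc - {0}) F" if "F holomorphic_on unit_disc" for F
      using that by (meson Diff_subset continuous_on_subset holomorphic_on_imp_continuous_on)
    have "continuous_on (unit_disc - {0}) (\<lambda>z. Re (w z))"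
      unfolding w_def using nz
      by (intro continuous_intros cont holomorphic_deriv hol) auto
    \<comment> \<open>As 0 is outside the domain, the limit 1 supplies a nearby point
      \<open>a\<close> of positivity, from which the sign spreads by connectedness.\<close>
    moreover have "\<forall>\<^sub>F z in at 0. Re (w z) > 0 \<and> z \<in> unit_disc - {0}"
    proof (intro eventually_conj)
      have "((\<lambda>z. Re (w z)) \<longlongrightarrow> Re 1) (at 0)"
        unfolding w_def by (intro tendsto_Re starlike_quotient_tendsto_1 hol)
      then show "\<forall>\<^sub>F z in at 0. Re (w z) > 0"
        by (rule order_tendstoD) simp
      show "\<forall>\<^sub>F z in at 0. z \<in> unit_disc - {0}"
        using eventually_at_in_open[of unit_disc 0] by simp
    qed
    then obtain a where "Re (w a) > 0" "a \<in> unit_disc - {0}"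
      using eventually_happens[of _ "at (0::complex)"] by auto
    moreover have "connected (unit_disc - {0})"
      by (rule connected_punctured_ball) simp
    ultimately show ?thesis
      using connected_nonzero_pos[of "unit_disc - {0}" "\<lambda>z. Re (w z)"] neq z by blast
  qed
  have "fully_starlike h g \<longleftrightarrow> (\<forall>z\<in>unit_disc - {0}. Re (w z) > 0)"
    by (simp add: fully_starlike_def w_def)
  also have "\<dots> \<longleftrightarrow> (\<forall>z\<in>unit_disc - {0}. Re (w z) \<noteq> 0)"
    using pos by force
  finally show ?thesis
    by (simp add: w_def)
qed

theorem theorem3:
  fixes f h g :: "complex \<Rightarrow> complex"
  assumes "class_SH0 f h g"
    and "\<And>z. z \<in> unit_disc \<Longrightarrow> deriv g z = z * deriv h z"
  shows "fully_starlike h g \<longleftrightarrow>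
    (\<forall>\<zeta> z. cmod \<zeta> = 1 \<and> 0 < cmod z \<and> cmod z < 1 \<longrightarrow>
       (h \<star> A_fun \<zeta>) z - cnj z * cnj ((h \<star> B_fun \<zeta>) z) \<noteq> 0)"
proof -
  have hol: "h holomorphic_on unit_disc" "h 0 = 0"
      "g holomorphic_on unit_disc" "g 0 = 0"
    using assms(1) by (auto simp: class_SH0_def class_SH_def class_H_def)
  let ?P = "\<lambda>z. z * deriv h z - cnj (z * deriv g z)"
  let ?Q = "\<lambda>z. h z + cnj (g z)"
  let ?E = "\<lambda>\<zeta> z. (h \<star> A_fun \<zeta>) z - cnj z * cnj ((h \<star> B_fun \<zeta>) z)"
  \<comment> \<open>Conjugation turns the \<open>cnj \<zeta>\<close> of \<open>B_fun\<close> into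
    \<open>\<zeta>\<close>, so the \<open>g\<close> terms acquire the same factors as the
    \<open>h\<close> terms. The subtraction gives \<open>z * deriv g z\<close> and
    \<open>g z\<close> the signs they have in \<open>?P\<close> and \<open>?Q\<close>.\<close>
  have E: "?E \<zeta> z = (\<zeta> + 1) * ?P z - (\<zeta> - 1) * ?Q z" if "z \<in> unit_disc" for \<zeta> z
  proof -
    have "cnj z * cnj ((h \<star> B_fun \<zeta>) z)
        = cnj ((cnj \<zeta> + 1) * (z * deriv g z) + (cnj \<zeta> - 1) * g z)"
      by (simp only: hadamard_B_fun[OF hol(1,3,4) assms(2) that] flip: complex_cnj_mult)
    then show ?thesis
      by (simp add: hadamard_A_fun[OF hol(1,2) that] algebra_simps)
  qed
  \<comment> \<open>The equivalence holds separately at each \<open>z\<close>; negating it pointwise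
    yields the criterion.\<close>
  have "(\<exists>\<zeta>. cmod \<zeta> = 1 \<and> ?E \<zeta> z = 0) \<longleftrightarrow> Re (?P z / ?Q z) = 0" if "z \<in> unit_disc - {0}" for z
    using ex_unimodular_iff_Re_eq_0[OF class_SH0_nonzero[OF assms(1) that], of "?P z"] E[of z] that by simp
  then have "fully_starlike h g \<longleftrightarrow> (\<forall>z\<in>unit_disc - {0}. \<forall>\<zeta>. cmod \<zeta> = 1 \<longrightarrow> ?E \<zeta> z \<noteq> 0)"
    unfolding fully_starlike_iff_Re_neq_0[OF assms(1)] by blast
  then show ?thesis
    by auto
qed

end
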